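(* The chromatic number of any triangle-free graph $G=(V,E)$ with local boxicity at most two is at most $18$.
   Context: All graphs are finite and simple. A real interval is either a bounded interval of $\mathbb{R}$ or $\mathbb{R}$ itself. For an integer $d'\ge 1$, a $d'$-box is a Cartesian product $I_1\times\cdots\times I_{d'}$ of real intervals; it is local in dimension $i$ if $I_i$ is bounded. A $d$-local box in dimension $d'\ge d$ is a $d'$-box that is local in at most $d$ dimensions. The local boxicity $\mathrm{lbox}(G)$ of a graph $G$ is the minimum integer $d$ such that, for some $d'$, there are $d$-local boxes $(B_v)_{v\in V(G)}$ in dimension $d'$ such that two distinct vertices $u,v$ are adjacent in $G$ if and only if $B_u\cap B_v\neq\emptyset$. *)

theory Defs
  imports "HOL-Analysis.Analysis"
begin

definition simple_graph :: "'a set \<Rightarrow> 'a set set \<Rightarrow> bool" where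
  "simple_graph V E \<longleftrightarrow>
     finite V \<and> (\<forall>e\<in>E. \<exists>u\<in>V. \<exists>v\<in>V. u \<noteq> v \<and> e = {u, v})"

(* The three vertices are automatically distinct, as edges of a simple graph have two elements. *)
definition triangle_free :: "'a set set \<Rightarrow> bool" where
  "triangle_free E \<longleftrightarrow> \<not> (\<exists>u v w. {u, v} \<in> E \<and> {v, w} \<in> E \<and> {u, w} \<in> E)"

definition proper_colouring :: "'a set \<Rightarrow> 'a set set \<Rightarrow> nat \<Rightarrow> ('a \<Rightarrow> nat) \<Rightarrow> bool" where
  "proper_colouring V E k c \<longleftrightarrow>
     c ` V \<subseteq> {..<k} \<and> (\<forall>u v. {u, v} \<in> E \<longrightarrow> c u \<noteq> c v)"

definition chromatic_number :: "'a set \<Rightarrow> 'a set set \<Rightarrow> nat" where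
  "chromatic_number V E = (LEAST k. \<exists>c. proper_colouring V E k c)"

(* A bounded interval may be open, closed or half-open and may be a single point,
   but it is not empty. *)
definition real_interval :: "real set \<Rightarrow> bool" where
  "real_interval I \<longleftrightarrow> I = UNIV \<or> (I \<noteq> {} \<and> is_interval I \<and> bounded I)"

(* A box of dimension n is given by its factors I 0, ..., I (n - 1); as a set of points it is
   PiE {..<n} I. *)
definition local_box :: "nat \<Rightarrow> nat \<Rightarrow> (nat \<Rightarrow> real set) \<Rightarrow> bool" where
  "local_box d n I \<longleftrightarrow>
     (\<forall>i<n. real_interval (I i)) \<and> card {i. i < n \<and> bounded (I i)} \<le> d"

definition local_box_representation ::
    "'a set \<Rightarrow> 'a set set \<Rightarrow> nat \<Rightarrow> nat \<Rightarrow> ('a \<Rightarrow> nat \<Rightarrow> real set) \<Rightarrow> bool" where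
  "local_box_representation V E d n B \<longleftrightarrow>
     1 \<le> n \<and> d \<le> n \<and> (\<forall>v\<in>V. local_box d n (B v)) \<and>
     (\<forall>u\<in>V. \<forall>v\<in>V. u \<noteq> v \<longrightarrow>
        ({u, v} \<in> E \<longleftrightarrow> PiE {..<n} (B u) \<inter> PiE {..<n} (B v) \<noteq> {}))"

definition lbox :: "'a set \<Rightarrow> 'a set set \<Rightarrow> nat" where
  "lbox V E = (LEAST d. \<exists>n B. local_box_representation V E d n B)"

(* The two minima range over nonempty sets. *)

lemma simple_graph_ex_colouring:
  assumes "simple_graph V E"
  shows "\<exists>k c. proper_colouring V E k c"
proof -
  obtain c :: "'a \<Rightarrow> nat" and k where "c ` V = {i. i < k}" "inj_on c V"
    using assms finite_imp_inj_to_nat_seg unfolding simple_graph_def by metis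
  moreover have "c u \<noteq> c v" if "{u, v} \<in> E" for u v
  proof -
    obtain x y where "x \<in> V" "y \<in> V" "x \<noteq> y" "{u, v} = {x, y}"
      using \<open>{u, v} \<in> E\<close> assms unfolding simple_graph_def by blast
    then show ?thesis
      using \<open>inj_on c V\<close> by (auto simp: doubleton_eq_iff inj_on_def)
  qed
  ultimately have "proper_colouring V E k c"
    by (simp add: proper_colouring_def lessThan_def)
  then show ?thesis by blast
qed

lemma simple_graph_ex_representation:
  assumes "simple_graph V E"
  shows "\<exists>d n B. local_box_representation V E d n B"
proof -
  obtain c :: "'a \<Rightarrow> nat" and k where k: "c ` V = {i. i < k}" and inj: "inj_on c V"
    using assms finite_imp_inj_to_nat_seg unfolding simple_graph_def by metis
  define B :: "'a \<Rightarrow> nat \<Rightarrow> real set" where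
    "B v i = (if c v = i then {0} else if \<exists>u\<in>V. c u = i \<and> {u, v} \<notin> E then {1} else {0..1})"
    for v i
  have ri: "real_interval (B v i)" for v i
    by (simp add: B_def real_interval_def is_interval_cc is_interval_1)
  have card: "card {i. i < Suc k \<and> P i} \<le> Suc k" for P
    using card_mono[of "{..<Suc k}" "{i. i < Suc k \<and> P i}"] by auto
  have "{u, v} \<in> E \<longleftrightarrow> PiE {..<Suc k} (B u) \<inter> PiE {..<Suc k} (B v) \<noteq> {}"
    if uv: "u \<in> V" "v \<in> V" "u \<noteq> v" for u v
  proof -
    have 1: "B u i \<inter> B v i \<noteq> {}" if "{u, v} \<in> E" for i
    proof -
      have "c u \<noteq> c v" using uv inj by (meson inj_onD)
      have "w = u" if "w \<in> V" "c w = c u" for w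
        using that uv inj by (meson inj_onD)
      moreover have "w = v" if "w \<in> V" "c w = c v" for w
        using that uv inj by (meson inj_onD)
      ultimately have "\<not> (\<exists>w\<in>V. c w = c u \<and> {w, v} \<notin> E)"
          "\<not> (\<exists>w\<in>V. c w = c v \<and> {w, u} \<notin> E)"
        using that by (metis, metis insert_commute)
      then show ?thesis
        using \<open>c u \<noteq> c v\<close> by (cases "c u = i"; cases "c v = i") (simp_all add: B_def)
    qed
    have 2: "B u (c u) \<inter> B v (c u) = {}" if "{u, v} \<notin> E"
    proof -
      have "c u \<noteq> c v" using uv inj by (meson inj_onD)
      moreover have "\<exists>w\<in>V. c w = c u \<and> {w, v} \<notin> E" using that uv by blast
      ultimately show ?thesis by (simp add: B_def)
    qed
    have 3: "c u < Suc k" using k uv by (auto simp: less_Suc_eq)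
    show ?thesis
    proof (cases "{u, v} \<in> E")
      case True
      then show ?thesis using 1 unfolding PiE_Int PiE_eq_empty_iff by simp
    next
      case False
      then show ?thesis using 2 3 unfolding PiE_Int PiE_eq_empty_iff by auto
    qed
  qed
  then have "local_box_representation V E (Suc k) (Suc k) B"
    using ri card by (auto simp: local_box_representation_def local_box_def)
  then show ?thesis by blast
qed

end

theory Submission
  imports Defs
begin

text \<open>
  Give every vertex a type, a set of exactly two dimensions containing its local ones. Vertices of
  disjoint types are adjacent, so no three types are pairwise disjoint.

  Two meeting rectangles of the same type that do not cross contain at least two of each other's
  corners. In a triangle-free graph every corner lies in at most one other rectangle, so the
  non-crossing edges inside the types form a 3-degenerate graph: four colours suffice for them.

  The remaining (coarse) edges join different types or crossing rectangles. If the types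
  pairwise meet, they form a star or lie in a triangle, and four colours suffice for the coarse
  edges: crossing is a partial order without chains of length three, different types of a star
  form an interval graph without triangles, and for only two types crossing and adjacency
  across types can be oriented together without paths of length two. This gives
  16 colours. If two types are disjoint, then all types meet their union. A vertex whose type is
  disjoint from some other one has no neighbour of its own type, so the vertices of this kind
  need 2 colours for each of the four stars; the others have at most two types
  and need 4 times 2 colours. This gives 16 colours again.
\<close>

section \<open>Colouring relations\<close>

text \<open>Stated for a relation rather than an edge set, so that classes of edges can be joined by
  disjunction. The diagonal is exempt because box adjacency is reflexive.\<close>

definition colourable :: "'a set \<Rightarrow> ('a \<Rightarrow> 'a \<Rightarrow> bool) \<Rightarrow> nat \<Rightarrow> bool" where
  "colourable X R k \<longleftrightarrow>
     (\<exists>c::'a \<Rightarrow> nat. (\<forall>v\<in>X. c v < k) \<and> (\<forall>u\<in>X. \<forall>v\<in>X. u \<noteq> v \<longrightarrow> R u v \<longrightarrow> c u \<noteq> c v))"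

lemma colourableE:
  assumes "colourable X R k"
  obtains c :: "'a \<Rightarrow> nat" where "\<And>v. v \<in> X \<Longrightarrow> c v < k"
    and "\<And>u v. \<lbrakk>u \<in> X; v \<in> X; u \<noteq> v; R u v\<rbrakk> \<Longrightarrow> c u \<noteq> c v"
  using assms that unfolding colourable_def by (elim exE conjE) metis

lemma colourable_mono:
  assumes "colourable X R k" "k \<le> m"
    and "\<And>u v. u \<in> X \<Longrightarrow> v \<in> X \<Longrightarrow> u \<noteq> v \<Longrightarrow> S u v \<Longrightarrow> R u v"
  shows "colourable X S m"
proof -
  obtain c where "\<And>v. v \<in> X \<Longrightarrow> c v < k"
      "\<And>u v. \<lbrakk>u \<in> X; v \<in> X; u \<noteq> v; R u v\<rbrakk> \<Longrightarrow> c u \<noteq> c v"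
    using assms(1) by (metis colourableE)
  then show ?thesis
    unfolding colourable_def using assms(2,3) by (intro exI[of _ c]) (auto intro: less_le_trans)
qed

lemma colourable_subset:
  assumes "colourable Y R k" "X \<subseteq> Y"
  shows "colourable X R k"
proof -
  obtain c where "\<And>v. v \<in> Y \<Longrightarrow> c v < k"
      "\<And>u v. \<lbrakk>u \<in> Y; v \<in> Y; u \<noteq> v; R u v\<rbrakk> \<Longrightarrow> c u \<noteq> c v"
    using assms(1) by (metis colourableE)
  then show ?thesis
    unfolding colourable_def using assms(2) by (intro exI[of _ c]) auto
qed

text \<open>The palettes are disjoint; a vertex in both sets keeps its colour from
  \<open>X\<close>.\<close>

lemma colourable_Un:
  assumes "colourable X R k" "colourable Y R m"
  shows "colourable (X \<union> Y) R (k + m)"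
proof -
  obtain c where c: "\<And>v. v \<in> X \<Longrightarrow> c v < k"
      "\<And>u v. \<lbrakk>u \<in> X; v \<in> X; u \<noteq> v; R u v\<rbrakk> \<Longrightarrow> c u \<noteq> c v"
    using assms(1) by (metis colourableE)
  obtain d where d: "\<And>v. v \<in> Y \<Longrightarrow> d v < m"
      "\<And>u v. \<lbrakk>u \<in> Y; v \<in> Y; u \<noteq> v; R u v\<rbrakk> \<Longrightarrow> d u \<noteq> d v"
    using assms(2) by (metis colourableE)
  define e where "e v = (if v \<in> X then c v else k + d v)" for v
  have "\<forall>v\<in>X \<union> Y. e v < k + m"
    using c(1) d(1) by (auto simp: e_def trans_less_add1)
  moreover have "e u \<noteq> e v" if "u \<in> X \<union> Y" "v \<in> X \<union> Y" "u \<noteq> v" "R u v" for u v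
    using that c d unfolding e_def by (cases "u \<in> X"; cases "v \<in> X") force+
  ultimately show ?thesis unfolding colourable_def by blast
qed

text \<open>Product colouring: the pair of colours is encoded as a number with last digit
  \<open>d v\<close> in base \<open>m\<close>.\<close>

lemma colourable_disj:
  assumes "colourable X R k" "colourable X S m"
  shows "colourable X (\<lambda>u v. R u v \<or> S u v) (k * m)"
proof -
  obtain c where c: "\<And>v. v \<in> X \<Longrightarrow> c v < k"
      "\<And>u v. \<lbrakk>u \<in> X; v \<in> X; u \<noteq> v; R u v\<rbrakk> \<Longrightarrow> c u \<noteq> c v"
    using assms(1) by (metis colourableE)
  obtain d where d: "\<And>v. v \<in> X \<Longrightarrow> d v < m"
      "\<And>u v. \<lbrakk>u \<in> X; v \<in> X; u \<noteq> v; S u v\<rbrakk> \<Longrightarrow> d u \<noteq> d v"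
    using assms(2) by (metis colourableE)
  define e where "e v = c v * m + d v" for v
  have "e v < k * m" if "v \<in> X" for v
  proof -
    have "e v < (c v + 1) * m" using d(1) that by (simp add: e_def)
    also have "\<dots> \<le> k * m" using c(1) that by (intro mult_le_mono1) (simp add: Suc_le_eq)
    finally show ?thesis .
  qed
  moreover have "e u \<noteq> e v" if "u \<in> X" "v \<in> X" "u \<noteq> v" "R u v \<or> S u v" for u v
  proof
    assume "e u = e v"
    have "e w div m = c w" "e w mod m = d w" if "w \<in> X" for w
      using d(1)[OF that] by (auto simp: e_def)
    then have "c u = c v" "d u = d v" using \<open>e u = e v\<close> that by metis+
    then show False using that c(2) d(2) by blast
  qed
  ultimately show ?thesis unfolding colourable_def by blast
qed

text \<open>Edges between different fibres of \<open>f\<close> are not counted, so all fibres share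
  one palette.\<close>

lemma colourable_fibres:
  fixes f :: "'a \<Rightarrow> 'b"
  assumes "\<And>t. colourable {v \<in> X. f v = t} R k"
  shows "colourable X (\<lambda>u v. f u = f v \<and> R u v) k"
proof -
  define P where "P t c \<longleftrightarrow> (\<forall>u\<in>X. f u = t \<longrightarrow> c u < k) \<and>
      (\<forall>u\<in>X. \<forall>v\<in>X. f u = t \<longrightarrow> f v = t \<longrightarrow> u \<noteq> v \<longrightarrow> R u v \<longrightarrow> c u \<noteq> c v)"
    for t and c :: "'a \<Rightarrow> nat"
  have "\<exists>c. P t c" for t
    using assms[of t] unfolding colourable_def P_def by (elim exE) (rule exI, auto)
  then obtain c where c: "\<And>t. P t (c t)" by metis
  show ?thesis
    unfolding colourable_def by (intro exI[of _ "\<lambda>v. c (f v) v"]) (use c in \<open>auto simp: P_def\<close>)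
qed

lemma colourable_labels:
  assumes "finite A" "f ` X \<subseteq> A"
  shows "colourable X (\<lambda>u v. f u \<noteq> f v) (card A)"
proof -
  obtain h where h: "bij_betw h A {0..<card A}"
    using ex_bij_betw_finite_nat[OF assms(1)] by blast
  have "h (f v) < card A" if "v \<in> X" for v
    using bij_betwE[OF h] assms(2) that by auto
  moreover have "h (f u) \<noteq> h (f v)" if "u \<in> X" "v \<in> X" "f u \<noteq> f v" for u v
    using bij_betw_imp_inj_on[OF h] assms(2) that by (auto dest: inj_onD)
  ultimately show ?thesis
    unfolding colourable_def by (intro exI[of _ "\<lambda>v. h (f v)"]) auto
qed

text \<open>Greedy colouring: remove a vertex with fewer than \<open>k\<close> neighbours, colour
  the rest, and give that vertex a colour missing among its neighbours.\<close>

lemma colourable_by_degeneracy: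
  assumes "finite X" "symp R"
    and "\<And>Y. Y \<subseteq> X \<Longrightarrow> Y \<noteq> {} \<Longrightarrow> \<exists>u\<in>Y. card {v \<in> Y. v \<noteq> u \<and> R u v} < k"
  shows "colourable X R k"
  using assms(1,3)
proof (induction "card X" arbitrary: X)
  case 0
  then show ?case by (simp add: colourable_def)
next
  case (Suc n)
  then obtain u where u: "u \<in> X" "card {v \<in> X. v \<noteq> u \<and> R u v} < k"
    by (metis card.empty order_refl nat.distinct(1))
  let ?Y = "X - {u}"
  have "n = card ?Y" "finite ?Y" using Suc u by auto
  moreover have "\<exists>u\<in>Y. card {v \<in> Y. v \<noteq> u \<and> R u v} < k" if "Y \<subseteq> ?Y" "Y \<noteq> {}" for Y
    using Suc.prems(2)[of Y] that by blast
  ultimately have "colourable ?Y R k" using Suc.hyps(1) by blast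
  then obtain c where c: "\<And>v. v \<in> ?Y \<Longrightarrow> c v < k"
      "\<And>v w. \<lbrakk>v \<in> ?Y; w \<in> ?Y; v \<noteq> w; R v w\<rbrakk> \<Longrightarrow> c v \<noteq> c w"
    by (metis colourableE)
  have "card (c ` {v \<in> X. v \<noteq> u \<and> R u v}) < card {..<k}"
    using u(2) card_image_le[of "{v \<in> X. v \<noteq> u \<and> R u v}" c] Suc.prems(1) by simp
  then have "\<not> {..<k} \<subseteq> c ` {v \<in> X. v \<noteq> u \<and> R u v}"
    using card_mono[of "c ` {v \<in> X. v \<noteq> u \<and> R u v}" "{..<k}"] Suc.prems(1) by auto
  then obtain a where a: "a < k" "a \<notin> c ` {v \<in> X. v \<noteq> u \<and> R u v}" by auto
  have "(c(u := a)) v \<noteq> (c(u := a)) w" if "v \<in> X" "w \<in> X" "v \<noteq> w" "R v w" for v w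
  proof -
    have "R w v" using \<open>symp R\<close> \<open>R v w\<close> by (rule sympD)
    consider "v = u" | "w = u" | "v \<noteq> u" "w \<noteq> u" by blast
    then show ?thesis
    proof cases
      case 1
      then have "c w \<noteq> a" using a(2) that by blast
      then show ?thesis using 1 that(3) by simp
    next
      case 2
      then have "c v \<noteq> a" using a(2) that \<open>R w v\<close> by blast
      then show ?thesis using 2 that(3) by simp
    next
      case 3
      then show ?thesis using c(2) that by simp
    qed
  qed
  then show ?case
    unfolding colourable_def using a(1) c(1) by (intro exI[of _ "c(u := a)"]) auto
qed

text \<open>Without directed paths of length two, a vertex with an incoming edge has no outgoing
  edge, so the presence of an incoming edge is a 2-colouring. The exception is a pair joined in both
  directions; such a pair has no further edges.\<close>

lemma colourable_no_2_paths:
  assumes "finite X"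
    and "\<And>u v w. \<lbrakk>u \<in> X; v \<in> X; w \<in> X; u \<noteq> v; v \<noteq> w; u \<noteq> w; R u v\<rbrakk> \<Longrightarrow> \<not> R v w"
  shows "colourable X (\<lambda>u v. R u v \<or> R v u) 2"
proof -
  obtain f :: "'a \<Rightarrow> nat" where f: "inj_on f X"
    using finite_imp_inj_to_nat_seg[OF assms(1)] by blast
  \<comment> \<open>The labels f break the tie when both R u v and R v u hold.\<close>
  define p where "p v \<longleftrightarrow> (\<exists>u\<in>X. u \<noteq> v \<and> R u v \<and> (R v u \<longrightarrow> f u < f v))" for v
  have p: "p u \<noteq> p v" if uv: "u \<in> X" "v \<in> X" "u \<noteq> v" "R u v" for u v
  proof (cases "R v u")
    case True
    have "p v \<longleftrightarrow> f u < f v"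
      unfolding p_def using True uv assms(2) by metis
    moreover have "p u \<longleftrightarrow> f v < f u"
      unfolding p_def using True uv assms(2) by metis
    moreover have "f u \<noteq> f v" using f uv by (meson inj_onD)
    ultimately show ?thesis by auto
  next
    case False
    then have "p v" unfolding p_def using uv by blast
    moreover have "\<not> p u" unfolding p_def using uv False assms(2) by metis
    ultimately show ?thesis by blast
  qed
  show ?thesis
    unfolding colourable_def
    by (rule exI[of _ "\<lambda>v. if p v then 1 else 0"]) (use p in \<open>force split: if_splits\<close>)
qed

section \<open>Intervals on a line\<close>

lemma ex_maximizer:
  fixes h :: "'a \<Rightarrow> real"
  assumes "finite X" "X \<noteq> {}"
  obtains u where "u \<in> X" "\<And>v. v \<in> X \<Longrightarrow> h v \<le> h u"
proof -
  have "Max (h ` X) \<in> h ` X" using assms by simp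
  then obtain u where "u \<in> X" "Max (h ` X) = h u" by blast
  then show thesis using that[of u] assms by (metis Max_ge finite_imageI imageI)
qed

text \<open>Requiring equal values on meeting intervals with the same label, and not only distinct values
  for distinct labels, makes the induction work: the intervals meeting the one that starts
  last pairwise meet, so they carry at most two labels, with one value each.\<close>

lemma labelled_intervals:
  fixes l r :: "'a \<Rightarrow> real"
  defines "M \<equiv> \<lambda>u v. l u \<le> r v \<and> l v \<le> r u"
  assumes "finite X"
    and "\<And>u v w. \<lbrakk>u \<in> X; v \<in> X; w \<in> X; M u v; M v w; M u w\<rbrakk> \<Longrightarrow> t u = t v \<or> t v = t w \<or> t u = t w"
  shows "\<exists>p::'a \<Rightarrow> bool. \<forall>u\<in>X. \<forall>v\<in>X. M u v \<longrightarrow> (p u = p v \<longleftrightarrow> t u = t v)"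
  using assms(2-)
proof (induction "card X" arbitrary: X)
  case 0
  then show ?case by auto
next
  case (Suc n)
  then obtain u where u: "u \<in> X" "\<And>v. v \<in> X \<Longrightarrow> l v \<le> l u"
    using ex_maximizer[of X l] by (metis card.empty nat.distinct(1))
  let ?Y = "X - {u}"
  have Y: "n = card ?Y" "finite ?Y" using Suc.hyps(2) Suc.prems(1) u by auto
  have "\<exists>p::'a \<Rightarrow> bool. \<forall>u\<in>?Y. \<forall>v\<in>?Y. M u v \<longrightarrow> (p u = p v \<longleftrightarrow> t u = t v)"
    by (rule Suc.hyps(1)[OF Y]) (rule Suc.prems(2), auto)
  then obtain p :: "'a \<Rightarrow> bool" where "\<forall>v\<in>?Y. \<forall>w\<in>?Y. M v w \<longrightarrow> (p v = p w \<longleftrightarrow> t v = t w)"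
    by blast
  then have p: "p v = p w \<longleftrightarrow> t v = t w" if "v \<in> ?Y" "w \<in> ?Y" "M v w" for v w
    using that by blast
  let ?Q = "{v \<in> ?Y. M v u}"
  have Q: "M v w" if "v \<in> ?Q" "w \<in> ?Q" for v w
    using that u(2) unfolding M_def by fastforce
  \<comment> \<open>The value that a single interval of \<open>?Q\<close> forces on
    \<open>u\<close>. All intervals of \<open>?Q\<close> force the same one, because
    \<open>u\<close> and any two of them carry at most two labels.\<close>
  define b where "b \<longleftrightarrow> (\<exists>v\<in>?Q. p v \<longleftrightarrow> t v = t u)"
  have b: "(p v = b) \<longleftrightarrow> t v = t u" if v: "v \<in> ?Q" for v
  proof -
    have "(p w \<longleftrightarrow> t w = t u) \<longleftrightarrow> (p v \<longleftrightarrow> t v = t u)" if w: "w \<in> ?Q" for w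
    proof -
      have "t v = t w \<or> t w = t u \<or> t v = t u"
        using Suc.prems(2)[of v w u] Q[OF v w] v w u(1) by auto
      moreover have "p v = p w \<longleftrightarrow> t v = t w" using p Q[OF v w] v w by blast
      ultimately show ?thesis by metis
    qed
    then show ?thesis unfolding b_def using v by blast
  qed
  have sym: "M v w \<longleftrightarrow> M w v" for v w unfolding M_def by auto
  have "((p(u := b)) v = (p(u := b)) w) \<longleftrightarrow> t v = t w" if "v \<in> X" "w \<in> X" "M v w" for v w
  proof (cases "v = u"; cases "w = u")
    assume "v = u" "w \<noteq> u"
    then have "w \<in> ?Q" using that sym by simp
    then show ?thesis using b[of w] \<open>v = u\<close> \<open>w \<noteq> u\<close> by auto
  next
    assume "v \<noteq> u" "w = u"
    then have "v \<in> ?Q" using that by simp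
    then show ?thesis using b[of v] \<open>v \<noteq> u\<close> \<open>w = u\<close> by auto
  qed (use p that in auto)
  then show ?case by blast
qed

section \<open>Rectangles\<close>

context
  fixes a b c d :: "'a \<Rightarrow> real"
begin

text \<open>Here and below, \<open>v\<close> stands for the rectangle with sides
  \<open>[a v, b v]\<close> and \<open>[c v, d v]\<close>.\<close>

definition rmeet :: "'a \<Rightarrow> 'a \<Rightarrow> bool" where
  "rmeet u v \<longleftrightarrow> a u \<le> b v \<and> a v \<le> b u \<and> c u \<le> d v \<and> c v \<le> d u"

text \<open>The inequalities are weak, so rectangles with common sides, and even equal ones, may
  cross.\<close>

definition rcross :: "'a \<Rightarrow> 'a \<Rightarrow> bool" where
  "rcross u v \<longleftrightarrow>
     a u \<le> a v \<and> b v \<le> b u \<and> c v \<le> c u \<and> d u \<le> d v \<or>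
     a v \<le> a u \<and> b u \<le> b v \<and> c u \<le> c v \<and> d v \<le> d u"

definition corner_in :: "'a \<Rightarrow> bool \<Rightarrow> bool \<Rightarrow> 'a \<Rightarrow> bool" where
  "corner_in u s t v \<longleftrightarrow>
     (let x = if s then a u else b u; y = if t then c u else d u
      in a v \<le> x \<and> x \<le> b v \<and> c v \<le> y \<and> y \<le> d v)"

text \<open>Corners are counted by their labels: those of a degenerate rectangle count with
  multiplicity.\<close>

definition ncorners :: "'a \<Rightarrow> 'a \<Rightarrow> nat" where
  "ncorners u v = of_bool (corner_in u True True v) + of_bool (corner_in u True False v) +
     of_bool (corner_in u False True v) + of_bool (corner_in u False False v)"

text \<open>Each of the four sides of the intersection comes from \<open>u\<close> or from
  \<open>v\<close>. Where two sides from the same rectangle meet, a corner of that rectangle lies in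
  the other one. There are at least two such places unless both vertical sides come from one
  rectangle and both horizontal sides from the other, which is a crossing.\<close>

lemma ncorners_ge_2:
  assumes "a u \<le> b u" "c u \<le> d u" "a v \<le> b v" "c v \<le> d v" "rmeet u v" "\<not> rcross u v"
  shows "2 \<le> ncorners u v + ncorners v u"
proof -
  have 1: "a v \<le> a u \<and> a u \<le> b v \<or> a u \<le> a v \<and> a v \<le> b u"
    "a v \<le> b u \<and> b u \<le> b v \<or> a u \<le> b v \<and> b v \<le> b u"
    "c v \<le> c u \<and> c u \<le> d v \<or> c u \<le> c v \<and> c v \<le> d u"
    "c v \<le> d u \<and> d u \<le> d v \<or> c u \<le> d v \<and> d v \<le> d u"
    using assms unfolding rmeet_def by linarith+
  show ?thesis
    using assms(1-4,6) 1
    unfolding ncorners_def corner_in_def Let_def rcross_def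
    by (elim disjE) (simp_all add: of_bool_def)
qed

text \<open>Double counting of corners lying in non-crossing neighbours. If all degrees were at
  least 4, there would be at least 2 per edge, hence at least 4 per rectangle on average; but each
  of the 4 corners of a rectangle lies in at most one neighbour. The two bounds coincide, so an
  extremal rectangle has to make one of them strict.\<close>

lemma low_degree:
  assumes fin: "finite X" "X \<noteq> {}"
    and ord: "\<And>v. v \<in> X \<Longrightarrow> a v \<le> b v" "\<And>v. v \<in> X \<Longrightarrow> c v \<le> d v"
    and tri: "\<And>u v w. \<lbrakk>u \<in> X; v \<in> X; w \<in> X; u \<noteq> v; v \<noteq> w; u \<noteq> w; rmeet u v; rmeet v w\<rbrakk>
      \<Longrightarrow> \<not> rmeet u w"
  shows "\<exists>u\<in>X. card {v \<in> X. v \<noteq> u \<and> rmeet u v \<and> \<not> rcross u v} < 4"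
proof (rule ccontr)
  assume neg: "\<not> ?thesis"
  define N where "N u v \<longleftrightarrow> u \<noteq> v \<and> rmeet u v \<and> \<not> rcross u v" for u v
  have Nsym: "N u v \<longleftrightarrow> N v u" for u v unfolding N_def rmeet_def rcross_def by auto
  define K where "K u v = of_bool (N u v) * ncorners u v" for u v
  have corner_meet: "rmeet u v" if "u \<in> X" "v \<in> X" "corner_in u s t v" for u v s t
    using that ord[of u] ord[of v] unfolding corner_in_def rmeet_def Let_def
    by (auto split: if_splits)
  have one: "(\<Sum>v\<in>X. of_bool (N u v) * of_bool (corner_in u s t v)) \<le> (1::nat)" if "u \<in> X" for u s t
  proof -
    \<comment> \<open>Two neighbours containing the same corner meet there and would form a triangle
      with \<open>u\<close>.\<close>
    have "v = w" if vw: "v \<in> X" "w \<in> X" "N u v" "N u w" "corner_in u s t v" "corner_in u s t w" for v w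
    proof (rule ccontr)
      assume "v \<noteq> w"
      have "rmeet v w"
        using vw(5,6) unfolding corner_in_def rmeet_def Let_def by (auto split: if_splits)
      then show False
        using tri[of u v w] vw \<open>u \<in> X\<close> \<open>v \<noteq> w\<close> unfolding N_def by blast
    qed
    then have "card {v \<in> X. N u v \<and> corner_in u s t v} \<le> 1"
      using fin(1) by (subst card_le_Suc0_iff_eq[unfolded One_nat_def[symmetric]]) auto
    moreover have "(\<Sum>v\<in>X. of_bool (N u v) * of_bool (corner_in u s t v)) = card {v \<in> X. N u v \<and> corner_in u s t v}"
      using fin(1) by (simp add: of_bool_conj[symmetric] sum_of_bool_eq Int_def)
    ultimately show ?thesis by simp
  qed
  have split4: "(\<Sum>v\<in>X. K u v) = (\<Sum>v\<in>X. of_bool (N u v) * of_bool (corner_in u True True v)) +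
      (\<Sum>v\<in>X. of_bool (N u v) * of_bool (corner_in u True False v)) +
      (\<Sum>v\<in>X. of_bool (N u v) * of_bool (corner_in u False True v)) +
      (\<Sum>v\<in>X. of_bool (N u v) * of_bool (corner_in u False False v))" for u
    unfolding K_def ncorners_def by (simp add: sum.distrib distrib_left)
  have upper: "(\<Sum>v\<in>X. K u v) \<le> 4" if "u \<in> X" for u
    unfolding split4
    using one[OF that, of True True] one[OF that, of True False]
      one[OF that, of False True] one[OF that, of False False] by linarith
  have pair: "2 * of_bool (N u v) \<le> K u v + K v u" if "u \<in> X" "v \<in> X" for u v
    using ncorners_ge_2[of u v] ord that Nsym unfolding K_def N_def by auto
  have lower: "8 \<le> (\<Sum>v\<in>X. 2 * of_bool (N u v) :: nat)" if "u \<in> X" for u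
  proof -
    have "(\<Sum>v\<in>X. of_bool (N u v) :: nat) = card {v \<in> X. v \<noteq> u \<and> rmeet u v \<and> \<not> rcross u v}"
      using fin(1) unfolding N_def by (simp add: sum_of_bool_eq Int_def eq_commute)
    moreover have "\<dots> \<ge> 4" using neg that by auto
    ultimately show ?thesis by (simp add: sum_distrib_left[symmetric])
  qed
  have lower': "8 \<le> (\<Sum>v\<in>X. K u v + K v u)" if "u \<in> X" for u
    by (rule order_trans[OF lower[OF that] sum_mono]) (use pair[OF that] in blast)
  have double: "2 * (\<Sum>u\<in>X. \<Sum>v\<in>X. K u v) = (\<Sum>u\<in>X. \<Sum>v\<in>X. K u v + K v u)"
    using sum.swap[of K X X] by (simp add: sum.distrib)
  \<comment> \<open>The lower left corner of this u0 is either uncovered or covered by a rectangle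
    inside the same vertical strip; either way the double count is strict.\<close>
  define A where "A = {v \<in> X. \<forall>w\<in>X. a v \<le> a w}"
  obtain u1 where u1: "u1 \<in> X" "\<And>v. v \<in> X \<Longrightarrow> - a v \<le> - a u1"
    using ex_maximizer[OF fin, of "\<lambda>v. - a v"] by blast
  then have "finite A" "A \<noteq> {}" using fin(1) by (auto simp: A_def)
  then obtain u0 where u0: "u0 \<in> A" "\<And>v. v \<in> A \<Longrightarrow> b v \<le> b u0"
    using ex_maximizer[of A b] by blast
  have u0X: "u0 \<in> X" using u0 by (simp add: A_def)
  show False
  proof (cases "\<exists>v\<in>X. N u0 v \<and> corner_in u0 True True v")
    case False
    then have "(\<Sum>v\<in>X. of_bool (N u0 v) * of_bool (corner_in u0 True True v)) = (0::nat)"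
      by (auto intro!: sum.neutral)
    then have "(\<Sum>v\<in>X. K u0 v) < 4"
      unfolding split4
      using one[OF u0X, of True False] one[OF u0X, of False True] one[OF u0X, of False False]
      by linarith
    then have "(\<Sum>u\<in>X. \<Sum>v\<in>X. K u v) < (\<Sum>u\<in>X. 4)"
      using upper u0X fin(1) by (intro sum_strict_mono_ex1) auto
    moreover have "(\<Sum>u\<in>X. 8) \<le> (\<Sum>u\<in>X. \<Sum>v\<in>X. K u v + K v u)"
      using lower' by (intro sum_mono)
    ultimately show False using double by simp
  next
    case True
    then obtain v where v: "v \<in> X" "N u0 v" "corner_in u0 True True v" by blast
    have "a v = a u0" using u0(1) v(1,3) unfolding A_def corner_in_def Let_def by (auto intro: antisym)
    then have "v \<in> A" using u0 v by (simp add: A_def)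
    then have "b v \<le> b u0" using u0 by blast
    \<comment> \<open>Otherwise \<open>v\<close> would span the full height of \<open>u0\<close>
      within its width, a crossing.\<close>
    have "d v < d u0"
      using v \<open>a v = a u0\<close> \<open>b v \<le> b u0\<close> unfolding N_def rcross_def corner_in_def Let_def by auto
    \<comment> \<open>Besides the lower left corner of \<open>u0\<close> in \<open>v\<close>, both
      upper corners of \<open>v\<close> lie in \<open>u0\<close>.\<close>
    then have "3 \<le> ncorners u0 v + ncorners v u0"
      using v(1,3) u0X \<open>a v = a u0\<close> \<open>b v \<le> b u0\<close> ord[of v] ord[of u0]
      unfolding ncorners_def corner_in_def Let_def by simp
    then have strict: "2 * of_bool (N u0 v) < K u0 v + K v u0"
      using v Nsym unfolding K_def by simp
    have "8 < (\<Sum>v\<in>X. K u0 v + K v u0)"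
    proof -
      have "(\<Sum>v\<in>X. 2 * of_bool (N u0 v) :: nat) < (\<Sum>v\<in>X. K u0 v + K v u0)"
        by (rule sum_strict_mono_ex1) (use fin(1) pair[OF u0X] strict v(1) in blast)+
      then show ?thesis using lower[OF u0X] by linarith
    qed
    then have "(\<Sum>u\<in>X. 8) < (\<Sum>u\<in>X. \<Sum>v\<in>X. K u v + K v u)"
      using fin(1) lower' u0X by (intro sum_strict_mono_ex1) blast+
    moreover have "(\<Sum>u\<in>X. \<Sum>v\<in>X. K u v) \<le> (\<Sum>u\<in>X. 4)"
      using upper by (intro sum_mono) auto
    ultimately show False using double by simp
  qed
qed

lemma non_crossing_colourable:
  assumes "finite X" "\<And>v. v \<in> X \<Longrightarrow> a v \<le> b v" "\<And>v. v \<in> X \<Longrightarrow> c v \<le> d v"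
    and "\<And>u v w. \<lbrakk>u \<in> X; v \<in> X; w \<in> X; u \<noteq> v; v \<noteq> w; u \<noteq> w; rmeet u v; rmeet v w\<rbrakk>
      \<Longrightarrow> \<not> rmeet u w"
  shows "colourable X (\<lambda>u v. rmeet u v \<and> \<not> rcross u v) 4"
proof (rule colourable_by_degeneracy)
  show "symp (\<lambda>u v. rmeet u v \<and> \<not> rcross u v)"
    unfolding rmeet_def rcross_def by (auto intro!: sympI)
  fix Y assume "Y \<subseteq> X" "Y \<noteq> {}"
  then show "\<exists>u\<in>Y. card {v \<in> Y. v \<noteq> u \<and> rmeet u v \<and> \<not> rcross u v} < 4"
    using assms by (intro low_degree) (auto dest: finite_subset, blast)
qed (fact assms(1))

end

section \<open>Intersecting families of pairs\<close>

text \<open>Pairwise meeting edges of a graph form a star or lie in a triangle. If there is no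
  common element, some pair avoids \<open>x\<close> and some pair avoids \<open>y\<close>, where
  \<open>{x, y}\<close> is a member; these two must be \<open>{y, z}\<close> and
  \<open>{x, z}\<close>, and a pair meeting all three is one of the three.\<close>

lemma intersecting_pairs:
  assumes "\<And>t. t \<in> F \<Longrightarrow> card t = 2" "\<And>t u. t \<in> F \<Longrightarrow> u \<in> F \<Longrightarrow> t \<inter> u \<noteq> {}"
  shows "(\<exists>s. \<forall>t\<in>F. s \<in> t) \<or>
    (\<exists>x y z. distinct [x, y, z] \<and> F \<subseteq> {{x, y}, {x, z}, {y, z}})"
proof (rule disjCI)
  assume neg: "\<not> (\<exists>x y z. distinct [x, y, z] \<and> F \<subseteq> {{x, y}, {x, z}, {y, z}})"
  show "\<exists>s. \<forall>t\<in>F. s \<in> t"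
  proof (rule ccontr)
    assume star: "\<not> ?thesis"
    then obtain t0 where t0: "t0 \<in> F" by blast
    then obtain x y where xy: "t0 = {x, y}" "x \<noteq> y"
      using assms(1) card_2_iff by metis
    obtain t1 where t1: "t1 \<in> F" "x \<notin> t1" using star by blast
    then have "y \<in> t1" using assms(2)[OF t0, of t1] xy by auto
    then obtain z where z: "t1 = {y, z}" "y \<noteq> z"
      using assms(1)[OF t1(1)] by (auto simp: card_2_iff)
    obtain t2 where t2: "t2 \<in> F" "y \<notin> t2" using star by blast
    have t2': "x \<in> t2" "z \<in> t2"
      using assms(2)[OF t0 t2(1)] assms(2)[OF t1(1) t2(1)] t2(2) xy z by auto
    have "x \<noteq> z" using t1 z by auto
    have t2_eq: "t2 = {x, z}"
      using assms(1)[OF t2(1)] t2' \<open>x \<noteq> z\<close> by (auto simp: card_2_iff)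
    have "t \<in> {{x, y}, {x, z}, {y, z}}" if t: "t \<in> F" for t
    proof -
      obtain p q where "t = {p, q}" "p \<noteq> q"
        using assms(1)[OF t] by (auto simp: card_2_iff)
      moreover have "t \<inter> {x, y} \<noteq> {}" "t \<inter> {y, z} \<noteq> {}" "t \<inter> {x, z} \<noteq> {}"
        using assms(2)[OF t] t0 t1(1) t2(1) xy(1) z(1) t2_eq by blast+
      ultimately show ?thesis using xy(2) z(2) \<open>x \<noteq> z\<close> by auto
    qed
    then show False
      using neg xy(2) z(2) \<open>x \<noteq> z\<close> by (metis distinct_length_2_or_more distinct_singleton subsetI)
  qed
qed

text \<open>The four candidates are the edges of a 4-cycle. Opposite edges are disjoint, so each of
  the two opposite couples misses a member, and the two remaining edges share an end.\<close>

lemma intersecting_transversal_pairs: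
  assumes "distinct [x, x', y, y']"
    and "\<And>t. t \<in> F \<Longrightarrow> t \<in> {{x, y}, {x, y'}, {x', y}, {x', y'}}"
    and "\<And>t u. t \<in> F \<Longrightarrow> u \<in> F \<Longrightarrow> t \<inter> u \<noteq> {}"
  shows "\<exists>s i j. distinct [s, i, j] \<and> F \<subseteq> {{s, i}, {s, j}}"
proof -
  have 1: "{x, y} \<notin> F \<or> {x', y'} \<notin> F" using assms(1) assms(3)[of "{x, y}" "{x', y'}"] by auto
  have 2: "{x, y'} \<notin> F \<or> {x', y} \<notin> F" using assms(1) assms(3)[of "{x, y'}" "{x', y}"] by auto
  have "F \<subseteq> {p, q} \<or> F \<subseteq> {p, r} \<or> F \<subseteq> {t, q} \<or> F \<subseteq> {t, r}"
    if "F \<subseteq> {p, q, r, t}" "p \<notin> F \<or> t \<notin> F" "q \<notin> F \<or> r \<notin> F" for p q r t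
    using that by blast
  from this[OF subsetI[OF assms(2)] 1 2]
  consider "F \<subseteq> {{x, y}, {x, y'}}" | "F \<subseteq> {{y, x}, {y, x'}}"
    | "F \<subseteq> {{y', x'}, {y', x}}" | "F \<subseteq> {{x', y'}, {x', y}}"
    by (metis insert_commute)
  then show ?thesis
  proof cases
    case 1
    then show ?thesis using assms(1) by (intro exI[of _ x] exI[of _ y] exI[of _ y']) auto
  next
    case 2
    then show ?thesis using assms(1) by (intro exI[of _ y] exI[of _ x] exI[of _ x']) auto
  next
    case 3
    then show ?thesis using assms(1) by (intro exI[of _ y'] exI[of _ x'] exI[of _ x]) auto
  next
    case 4
    then show ?thesis using assms(1) by (intro exI[of _ x'] exI[of _ y'] exI[of _ y]) auto
  qed
qed

section \<open>Boxes with two bounded sides\<close>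

text \<open>In a dimension outside \<open>T u \<inter> T v\<close> one of the two boxes counts as
  unbounded, so only common dimensions can separate them.\<close>

definition box_adj :: "('a \<Rightarrow> nat set) \<Rightarrow> ('a \<Rightarrow> nat \<Rightarrow> real) \<Rightarrow> ('a \<Rightarrow> nat \<Rightarrow> real) \<Rightarrow> 'a \<Rightarrow> 'a \<Rightarrow> bool" where
  "box_adj T l r u v \<longleftrightarrow> (\<forall>i\<in>T u \<inter> T v. l u i \<le> r v i \<and> l v i \<le> r u i)"

locale triangle_free_boxes =
  fixes V :: "'a set" and T :: "'a \<Rightarrow> nat set" and l r :: "'a \<Rightarrow> nat \<Rightarrow> real"
  assumes finite_V: "finite V"
    and card_T: "v \<in> V \<Longrightarrow> card (T v) = 2"
    and l_le_r: "v \<in> V \<Longrightarrow> l v i \<le> r v i"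
    and no_triangle: "\<lbrakk>u \<in> V; v \<in> V; w \<in> V; u \<noteq> v; v \<noteq> w; u \<noteq> w;
      box_adj T l r u v; box_adj T l r v w\<rbrakk> \<Longrightarrow> \<not> box_adj T l r u w"
begin

abbreviation adj :: "'a \<Rightarrow> 'a \<Rightarrow> bool" where
  "adj \<equiv> box_adj T l r"

definition sub :: "nat \<Rightarrow> 'a \<Rightarrow> 'a \<Rightarrow> bool" where
  "sub i u v \<longleftrightarrow> l v i \<le> l u i \<and> r u i \<le> r v i"

text \<open>This is \<open>rcross\<close> without a chosen order of the two dimensions.\<close>

definition cross :: "'a \<Rightarrow> 'a \<Rightarrow> bool" where
  "cross u v \<longleftrightarrow> T u = T v \<and> (\<exists>i\<in>T u. sub i u v \<and> (\<forall>j\<in>T u - {i}. sub j v u))"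

definition coarse :: "'a \<Rightarrow> 'a \<Rightarrow> bool" where
  "coarse u v \<longleftrightarrow> adj u v \<and> (T u \<noteq> T v \<or> cross u v)"

lemma T_pair:
  assumes "v \<in> V"
  obtains i j where "T v = {i, j}" "i \<noteq> j"
  using card_T[OF assms] by (metis card_2_iff)

lemma T_pair_at:
  assumes "v \<in> V" "s \<in> T v"
  obtains i where "T v = {s, i}" "s \<noteq> i"
proof -
  obtain i j where "T v = {i, j}" "i \<noteq> j" by (metis T_pair assms(1))
  then show thesis using assms(2) that[of i] that[of j] by (auto simp: insert_commute)
qed

lemma cross_pair:
  assumes "cross u v" "T u = {i, j}" "i \<noteq> j"
  shows "sub i u v \<and> sub j v u \<or> sub j u v \<and> sub i v u"
proof -
  obtain k where k: "k \<in> {i, j}" "sub k u v" "\<And>m. m \<in> {i, j} - {k} \<Longrightarrow> sub m v u"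
    using assms(1) unfolding cross_def assms(2) by blast
  then consider "k = i" | "k = j" by blast
  then show ?thesis by cases (use k assms(3) in auto)
qed

lemma T_Int:
  assumes "u \<in> V" "v \<in> V" "T u \<noteq> T v" "s \<in> T u" "s \<in> T v"
  shows "T u \<inter> T v = {s}"
proof -
  obtain i j where "T u = {i, j}" using T_pair assms(1) by metis
  moreover obtain p q where "T v = {p, q}" using T_pair assms(2) by metis
  ultimately show ?thesis using assms(3-) by auto
qed

text \<open>Boxes of one type are rectangles in the plane of its two dimensions, and all types share
  the four colours.\<close>

lemma non_crossing: "colourable V (\<lambda>u v. T u = T v \<and> (adj u v \<and> \<not> cross u v)) 4"
proof (rule colourable_fibres)
  fix t
  let ?X = "{v \<in> V. T v = t}"
  show "colourable ?X (\<lambda>u v. adj u v \<and> \<not> cross u v) 4"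
  proof (cases "?X = {}")
    case True
    then show ?thesis unfolding colourable_def by blast
  next
    case False
    then obtain v where "v \<in> V" "T v = t" by blast
    then obtain i j where t: "t = {i, j}" "i \<noteq> j" by (metis T_pair)
    let ?m = "rmeet (\<lambda>v. l v i) (\<lambda>v. r v i) (\<lambda>v. l v j) (\<lambda>v. r v j)"
    let ?c = "rcross (\<lambda>v. l v i) (\<lambda>v. r v i) (\<lambda>v. l v j) (\<lambda>v. r v j)"
    have adj: "adj u v \<longleftrightarrow> ?m u v" if "u \<in> ?X" "v \<in> ?X" for u v
      using that t unfolding box_adj_def rmeet_def by auto
    have "colourable ?X (\<lambda>u v. ?m u v \<and> \<not> ?c u v) 4"
    proof (rule non_crossing_colourable)
      fix u v w
      assume "u \<in> ?X" "v \<in> ?X" "w \<in> ?X" "u \<noteq> v" "v \<noteq> w" "u \<noteq> w" "?m u v" "?m v w"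
      then show "\<not> ?m u w" using no_triangle[of u v w] adj by auto
    qed (use finite_V l_le_r in auto)
    then show ?thesis
    proof (rule colourable_mono)
      fix u v assume uv: "u \<in> ?X" "v \<in> ?X" "adj u v \<and> \<not> cross u v"
      then have "T u = {i, j}" "T v = {i, j}" using t by auto
      then have "\<not> ?c u v"
        using uv(3) t(2) unfolding cross_def sub_def rcross_def by auto
      then show "?m u v \<and> \<not> ?c u v" using adj uv by blast
    qed simp
  qed
qed

section \<open>Coarse edges\<close>

lemma adj_colourable:
  assumes "X \<subseteq> V" "colourable X coarse k"
  shows "colourable X adj (4 * k)"
proof -
  have "colourable X (\<lambda>u v. T u = T v \<and> (adj u v \<and> \<not> cross u v)) 4"
    using colourable_subset[OF non_crossing assms(1)] .
  from colourable_disj[OF this assms(2)] show ?thesis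
    by (rule colourable_mono) (auto simp: coarse_def)
qed

text \<open>Different types have only \<open>s\<close> in common, so adjacency between them means
  that the intervals in \<open>s\<close> meet. Three pairwise meeting intervals with three types
  would be a triangle, which is the condition of \<open>labelled_intervals\<close> with the type as
  label.\<close>

lemma star_labels:
  assumes "X \<subseteq> V" "\<And>v. v \<in> X \<Longrightarrow> s \<in> T v"
  shows "colourable X (\<lambda>u v. T u \<noteq> T v \<and> adj u v) 2"
proof -
  let ?M = "\<lambda>u v. l u s \<le> r v s \<and> l v s \<le> r u s"
  have adj: "adj u v \<longleftrightarrow> ?M u v" if "u \<in> X" "v \<in> X" "T u \<noteq> T v" for u v
  proof -
    have "T u \<inter> T v = {s}" using that assms by (intro T_Int) auto
    then show ?thesis unfolding box_adj_def by simp
  qed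
  have "\<exists>p::'a \<Rightarrow> bool. \<forall>u\<in>X. \<forall>v\<in>X. ?M u v \<longrightarrow> (p u = p v \<longleftrightarrow> T u = T v)"
  proof (rule labelled_intervals)
    show "finite X" using assms(1) finite_V finite_subset by blast
    fix u v w
    assume X: "u \<in> X" "v \<in> X" "w \<in> X" and M: "?M u v" "?M v w" "?M u w"
    show "T u = T v \<or> T v = T w \<or> T u = T w"
    proof (rule ccontr)
      assume neq: "\<not> ?thesis"
      then have "adj u v" "adj v w" "adj u w" using adj X M by blast+
      moreover have "u \<noteq> v" "v \<noteq> w" "u \<noteq> w" using neq by auto
      ultimately show False using no_triangle[of u v w] X assms(1) by blast
    qed
  qed
  then obtain p :: "'a \<Rightarrow> bool" where p: "\<forall>u\<in>X. \<forall>v\<in>X. ?M u v \<longrightarrow> (p u = p v \<longleftrightarrow> T u = T v)" by blast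
  have "colourable X (\<lambda>u v. p u \<noteq> p v) (card (UNIV :: bool set))"
    by (rule colourable_labels) auto
  then show ?thesis
  proof (rule colourable_mono)
    fix u v assume "u \<in> X" "v \<in> X" "T u \<noteq> T v \<and> adj u v"
    then show "p u \<noteq> p v" using p adj by blast
  qed simp
qed

text \<open>Along \<open>R\<close> a box shrinks in \<open>s\<close> and grows in its other
  dimension. This orients the crossing pairs transitively, and a path of length two would be a
  triangle. Two colours for the crossings are multiplied by two for the edges between types.\<close>

lemma star_coarse:
  assumes "X \<subseteq> V" "\<And>v. v \<in> X \<Longrightarrow> s \<in> T v"
  shows "colourable X coarse 4"
proof -
  define R where "R u v \<longleftrightarrow> T u = T v \<and> sub s v u \<and> (\<forall>i\<in>T u - {s}. sub i u v)" for u v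
  have R_adj: "adj u v" if "u \<in> X" "v \<in> X" "R u v" for u v
    unfolding box_adj_def
  proof
    fix i assume "i \<in> T u \<inter> T v"
    then have "sub i u v \<or> sub i v u" using that(3) unfolding R_def by blast
    then show "l u i \<le> r v i \<and> l v i \<le> r u i"
      using l_le_r[of u i] l_le_r[of v i] that assms(1) unfolding sub_def by auto
  qed
  have R_trans: "R u w" if "R u v" "R v w" for u v w
    using that unfolding R_def sub_def by force
  have "colourable X (\<lambda>u v. R u v \<or> R v u) 2"
  proof (rule colourable_no_2_paths)
    show "finite X" using assms(1) finite_V finite_subset by blast
    fix u v w
    assume "u \<in> X" "v \<in> X" "w \<in> X" "u \<noteq> v" "v \<noteq> w" "u \<noteq> w" "R u v"
    then show "\<not> R v w"
      using no_triangle[of u v w] R_adj R_trans assms(1) by blast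
  qed
  from colourable_disj[OF star_labels[OF assms] this] show ?thesis
  proof (rule colourable_mono)
    fix u v assume uv: "u \<in> X" "v \<in> X" "coarse u v"
    show "(T u \<noteq> T v \<and> adj u v) \<or> (R u v \<or> R v u)"
    proof (cases "T u = T v")
      case True
      obtain i where T: "T u = {s, i}" "s \<noteq> i" by (metis T_pair_at uv(1) assms subsetD)
      have "cross u v" using uv(3) True unfolding coarse_def by blast
      moreover have "{s, i} - {s} = {i}" using T(2) by blast
      ultimately show ?thesis
        using cross_pair[OF _ T] True unfolding R_def True[symmetric] T(1) by auto
    qed (use uv in \<open>simp add: coarse_def\<close>)
  qed auto
qed

text \<open>All edges between the two types are oriented from the first type to the second, and crossing
  pairs towards the box that is shorter in the common dimension s for the first type, longer
  for the second. Along a path of this orientation the intersection in s persists.\<close>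

lemma two_types_coarse:
  assumes "X \<subseteq> V" "distinct [s, i, j]" "\<And>v. v \<in> X \<Longrightarrow> T v \<in> {{s, i}, {s, j}}"
  shows "colourable X coarse 2"
proof -
  define A where "A = {s, i}"
  define B where "B = {s, j}"
  have AB: "A \<noteq> B" "A \<inter> B = {s}"
    using assms(2) unfolding A_def B_def by auto
  define R where "R u v \<longleftrightarrow>
      T u = A \<and> T v = A \<and> sub s v u \<and> sub i u v \<or>
      T u = A \<and> T v = B \<and> adj u v \<or>
      T u = B \<and> T v = B \<and> sub s u v \<and> sub j v u" for u v
  have R_adj: "adj u v" if "u \<in> X" "v \<in> X" "R u v" for u v
    unfolding box_adj_def
  proof
    fix k assume k: "k \<in> T u \<inter> T v"
    then have "sub k u v \<or> sub k v u \<or> adj u v"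
      using that(3) unfolding R_def by (auto simp: A_def B_def)
    then show "l u k \<le> r v k \<and> l v k \<le> r u k"
      using k l_le_r[of u k] l_le_r[of v k] that assms(1)
      unfolding sub_def box_adj_def by auto
  qed
  have R_trans: "adj u w" if X: "u \<in> X" "v \<in> X" "w \<in> X" and R: "R u v" "R v w" for u v w
  proof -
    have 1: "adj x y \<longleftrightarrow> l x s \<le> r y s \<and> l y s \<le> r x s" if "T x = A" "T y = B" for x y
      unfolding box_adj_def that AB by simp
    \<comment> \<open>No step of \<open>R\<close> leads from type \<open>B\<close> back to type
      \<open>A\<close>.\<close>
    consider "T u = A" "T v = A" "T w = A" | "T u = A" "T v = A" "T w = B"
      | "T u = A" "T v = B" "T w = B" | "T u = B" "T v = B" "T w = B"
      using R AB(1) unfolding R_def by metis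
    then show ?thesis
    proof cases
      case 1
      then have "R u w" using R AB(1) unfolding R_def sub_def by auto
      then show ?thesis using R_adj X by blast
    next
      case 2
      then have "sub s v u" "adj v w" using R AB(1) unfolding R_def by simp_all
      then show ?thesis using 2 1 unfolding sub_def by force
    next
      case 3
      then have "adj u v" "sub s v w" using R AB(1) unfolding R_def by simp_all
      then show ?thesis using 3 1 unfolding sub_def by force
    next
      case 4
      then have "R u w" using R AB(1) unfolding R_def sub_def by auto
      then show ?thesis using R_adj X by blast
    qed
  qed
  have "colourable X (\<lambda>u v. R u v \<or> R v u) 2"
  proof (rule colourable_no_2_paths)
    show "finite X" using assms(1) finite_V finite_subset by blast
    fix u v w
    assume "u \<in> X" "v \<in> X" "w \<in> X" "u \<noteq> v" "v \<noteq> w" "u \<noteq> w" "R u v"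
    then show "\<not> R v w"
      using no_triangle[of u v w] R_adj R_trans assms(1) by blast
  qed
  then show ?thesis
  proof (rule colourable_mono)
    fix u v assume uv: "u \<in> X" "v \<in> X" "coarse u v"
    have sym: "adj v u" using uv(3) unfolding coarse_def box_adj_def by blast
    consider "T u = A" "T v = A" | "T u = B" "T v = B" | "T u = A" "T v = B" | "T u = B" "T v = A"
      using assms(3) uv unfolding A_def B_def by blast
    then show "R u v \<or> R v u"
    proof cases
      case 1
      then have "cross u v" using uv(3) unfolding coarse_def by simp
      from cross_pair[OF this 1(1)[unfolded A_def]] show ?thesis
        using 1 assms(2) unfolding R_def by auto
    next
      case 2
      then have "cross u v" using uv(3) unfolding coarse_def by simp
      from cross_pair[OF this 2(1)[unfolded B_def]] show ?thesis
        using 2 assms(2) unfolding R_def by auto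
    next
      case 3
      then show ?thesis using uv(3) unfolding R_def coarse_def by blast
    next
      case 4
      then show ?thesis using sym unfolding R_def by blast
    qed
  qed simp
qed

section \<open>Pairwise meeting types, and two disjoint types\<close>

lemma intersecting_types_colourable:
  assumes "\<And>u v. u \<in> V \<Longrightarrow> v \<in> V \<Longrightarrow> T u \<inter> T v \<noteq> {}"
  shows "colourable V adj 16"
proof -
  have "(\<exists>s. \<forall>t\<in>T ` V. s \<in> t) \<or>
      (\<exists>x y z. distinct [x, y, z] \<and> T ` V \<subseteq> {{x, y}, {x, z}, {y, z}})"
    using card_T assms by (intro intersecting_pairs) auto
  then have "colourable V coarse 4"
  proof (elim disjE exE conjE)
    fix s assume "\<forall>t\<in>T ` V. s \<in> t"
    then show ?thesis by (intro star_coarse) auto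
  next
    fix x y z assume xyz: "distinct [x, y, z]" and T: "T ` V \<subseteq> {{x, y}, {x, z}, {y, z}}"
    \<comment> \<open>Any two sides of the triangle share a dimension, so two families of at most
      two types cover \<open>V\<close>, with two colours for each.\<close>
    let ?A = "{v \<in> V. T v \<in> {{x, y}, {x, z}}}" and ?B = "{v \<in> V. T v \<in> {{y, z}, {y, x}}}"
    have "colourable ?A coarse 2" using xyz by (intro two_types_coarse[of _ x y z]) auto
    moreover have "colourable ?B coarse 2" using xyz by (intro two_types_coarse[of _ y z x]) auto
    ultimately have "colourable (?A \<union> ?B) coarse (2 + 2)" by (rule colourable_Un)
    moreover have "?A \<union> ?B = V" using T by auto
    ultimately show ?thesis by simp
  qed
  then show ?thesis using adj_colourable[of V 4] by simp
qed

lemma disjoint_types_colourable: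
  assumes ab: "a \<in> V" "b \<in> V" "T a \<inter> T b = {}"
  shows "colourable V adj 16"
proof -
  define Z where "Z = {z \<in> V. \<exists>w\<in>V. T z \<inter> T w = {}}"
  have disj_adj: "adj u v" if "T u \<inter> T v = {}" for u v
    using that by (simp add: box_adj_def)
  have disj_neq: "u \<noteq> v" if "u \<in> V" "T u \<inter> T v = {}" for u v
    using card_T[OF that(1)] that(2) by auto
  have meets: "T z \<inter> (T a \<union> T b) \<noteq> {}" if "z \<in> V" for z
  proof
    assume "T z \<inter> (T a \<union> T b) = {}"
    then have "T z \<inter> T a = {}" "T z \<inter> T b = {}" by blast+
    then show False
      using no_triangle[of z a b] disj_adj disj_neq ab that by blast
  qed
  have fin: "finite (T a \<union> T b)" "card (T a \<union> T b) = 4"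
  proof -
    have "finite (T a)" "finite (T b)"
      using card_T[OF ab(1)] card_T[OF ab(2)] card.infinite by fastforce+
    then show "finite (T a \<union> T b)" "card (T a \<union> T b) = 4"
      using card_Un_disjoint[of "T a" "T b"] ab card_T by auto
  qed
  have "colourable Z adj 8"
  proof -
    \<comment> \<open>The value of \<open>g\<close> sorts \<open>Z\<close> into four stars, one for
      each dimension of \<open>T a \<union> T b\<close>.\<close>
    define g where "g z = (SOME s. s \<in> T z \<inter> (T a \<union> T b))" for z
    have g: "g z \<in> T z \<inter> (T a \<union> T b)" if "z \<in> V" for z
      unfolding g_def some_in_eq using meets[OF that] .
    have "colourable Z (\<lambda>u v. g u \<noteq> g v) 4"
    proof -
      have "g ` Z \<subseteq> T a \<union> T b" using g unfolding Z_def by blast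
      then show ?thesis using colourable_labels[OF fin(1)] fin(2) by metis
    qed
    moreover have "colourable Z (\<lambda>u v. g u = g v \<and> adj u v) 2"
    proof (rule colourable_fibres)
      fix s
      have "colourable {v \<in> Z. g v = s} (\<lambda>u v. T u \<noteq> T v \<and> adj u v) 2"
        using g by (intro star_labels[of _ s]) (auto simp: Z_def)
      then show "colourable {v \<in> Z. g v = s} adj 2"
      proof (rule colourable_mono)
        fix u v assume uv: "u \<in> {v \<in> Z. g v = s}" "v \<in> {v \<in> Z. g v = s}" "u \<noteq> v" "adj u v"
        then obtain w where w: "w \<in> V" "T u \<inter> T w = {}" unfolding Z_def by blast
        \<comment> \<open>If the types were equal, \<open>w\<close> would be adjacent to both ends
          of the edge.\<close>
        have "T u \<noteq> T v"
        proof
          assume "T u = T v"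
          then show False
            using no_triangle[of u v w] disj_adj[of u w] disj_adj[of v w]
              disj_neq[of u w] disj_neq[of v w] uv w by (auto simp: Z_def)
        qed
        then show "T u \<noteq> T v \<and> adj u v" using uv by blast
      qed simp
    qed
    ultimately have "colourable Z (\<lambda>u v. g u \<noteq> g v \<or> g u = g v \<and> adj u v) (4 * 2)"
      by (rule colourable_disj)
    then show ?thesis by (rule colourable_mono) auto
  qed
  moreover have "colourable (V - Z) adj 8"
  proof -
    obtain x x' where x: "T a = {x, x'}" "x \<noteq> x'" using T_pair ab(1) by metis
    obtain y y' where y: "T b = {y, y'}" "y \<noteq> y'" using T_pair ab(2) by metis
    have int: "T u \<inter> T v \<noteq> {}" if "u \<in> V - Z" "v \<in> V" for u v
      using that by (auto simp: Z_def)
    \<comment> \<open>A type outside \<open>Z\<close> meets both of the disjoint pairs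
      \<open>T a\<close> and \<open>T b\<close>, so it takes one element from each.\<close>
    have "t \<in> {{x, y}, {x, y'}, {x', y}, {x', y'}}" if "t \<in> T ` (V - Z)" for t
    proof -
      obtain v where v: "v \<in> V - Z" "t = T v" using \<open>t \<in> T ` (V - Z)\<close> by blast
      obtain i j where "T v = {i, j}" by (metis T_pair v(1) DiffD1)
      then show ?thesis
        using int[OF v(1) ab(1)] int[OF v(1) ab(2)] v(2) x y ab(3) by auto
    qed
    then have "\<exists>s i j. distinct [s, i, j] \<and> T ` (V - Z) \<subseteq> {{s, i}, {s, j}}"
      using x y ab(3) int by (intro intersecting_transversal_pairs[of x x' y y']) auto
    then obtain s i j where "distinct [s, i, j]" "T ` (V - Z) \<subseteq> {{s, i}, {s, j}}" by blast
    then have "colourable (V - Z) coarse 2"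
      by (intro two_types_coarse[of _ s i j]) auto
    then show ?thesis using adj_colourable[of "V - Z" 2] by simp
  qed
  ultimately have "colourable (Z \<union> (V - Z)) adj (8 + 8)" by (rule colourable_Un)
  moreover have "Z \<union> (V - Z) = V" unfolding Z_def by blast
  ultimately show ?thesis by simp
qed

theorem adj_colourable_16: "colourable V adj 16"
  using intersecting_types_colourable disjoint_types_colourable by blast

end

section \<open>Local boxicity\<close>

text \<open>Choose a point in every nonempty pairwise intersection and replace each interval by the
  hull of the chosen points in it. The hull stays inside the interval and keeps a witness for every
  meeting.\<close>

lemma closed_intervals:
  fixes B :: "'a \<Rightarrow> real set"
  assumes "finite V" "\<And>v. v \<in> V \<Longrightarrow> B v \<noteq> {}" "\<And>v. v \<in> V \<Longrightarrow> is_interval (B v)"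
  shows "\<exists>l r :: 'a \<Rightarrow> real. (\<forall>v\<in>V. l v \<le> r v) \<and>
    (\<forall>u\<in>V. \<forall>v\<in>V. B u \<inter> B v \<noteq> {} \<longleftrightarrow> l u \<le> r v \<and> l v \<le> r u)"
proof -
  \<comment> \<open>The diagonal puts a point into every \<open>B v\<close>. An empty intersection
    yields an arbitrary point, which is harmless: any finite superset of the witnesses would
    do.\<close>
  define P where "P = (\<lambda>(u, v). SOME x. x \<in> B u \<inter> B v) ` (V \<times> V)"
  have P: "\<exists>x\<in>P. x \<in> B u \<inter> B v" if "u \<in> V" "v \<in> V" "B u \<inter> B v \<noteq> {}" for u v
  proof -
    have "(SOME x. x \<in> B u \<inter> B v) \<in> B u \<inter> B v" unfolding some_in_eq using that(3) .
    moreover have "(SOME x. x \<in> B u \<inter> B v) \<in> P" unfolding P_def using that(1,2) by force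
    ultimately show ?thesis by blast
  qed
  have fin: "finite (P \<inter> B v)" for v unfolding P_def using assms(1) by simp
  have ne: "P \<inter> B v \<noteq> {}" if "v \<in> V" for v using P[of v v] assms(2) that by auto
  define l where "l v = Min (P \<inter> B v)" for v
  define r where "r v = Max (P \<inter> B v)" for v
  have in_B: "l v \<in> B v" "r v \<in> B v" if "v \<in> V" for v
    using Min_in[OF fin ne[OF that]] Max_in[OF fin ne[OF that]] unfolding l_def r_def by auto
  have bds: "l v \<le> x" "x \<le> r v" if "x \<in> P" "x \<in> B v" for x v
    using fin[of v] that unfolding l_def r_def by auto
  have lr: "l v \<le> r v" if "v \<in> V" for v
    using ne[OF that] bds[of _ v] by force
  have sub: "x \<in> B v" if "v \<in> V" "l v \<le> x" "x \<le> r v" for v x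
    using assms(3)[OF that(1)] in_B[OF that(1)] that unfolding is_interval_1 by blast
  have "B u \<inter> B v \<noteq> {} \<longleftrightarrow> l u \<le> r v \<and> l v \<le> r u" if uv: "u \<in> V" "v \<in> V" for u v
  proof
    assume "B u \<inter> B v \<noteq> {}"
    then obtain x where "x \<in> P" "x \<in> B u" "x \<in> B v" using P uv by blast
    then show "l u \<le> r v \<and> l v \<le> r u" using bds order_trans by metis
  next
    assume "l u \<le> r v \<and> l v \<le> r u"
    then have "max (l u) (l v) \<in> B u" "max (l u) (l v) \<in> B v"
      using sub uv lr by simp_all
    then show "B u \<inter> B v \<noteq> {}" by blast
  qed
  then show ?thesis using lr by (intro exI[of _ l] exI[of _ r] conjI ballI) auto
qed

lemma representation_colourable:
  assumes E: "simple_graph V E" "triangle_free E" and rep: "local_box_representation V E d n B"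
    and d: "d \<le> 2"
  shows "colourable V (\<lambda>u v. {u, v} \<in> E) 16"
proof -
  have fin: "finite V" using E(1) by (simp add: simple_graph_def)
  have box: "real_interval (B v i)" if "v \<in> V" "i < n" for v i
    using rep that unfolding local_box_representation_def local_box_def by blast
  define A where "A v = {i. i < n \<and> bounded (B v i)}" for v
  have "\<exists>T. A v \<subseteq> T \<and> card T = 2" if "v \<in> V" for v
  proof -
    have "card (A v) \<le> d"
      using rep that unfolding local_box_representation_def local_box_def A_def by blast
    moreover have "finite (A v)" unfolding A_def by simp
    \<comment> \<open>The new dimensions \<open>n\<close> and \<open>n + 1\<close> supply enough
      elements to pad \<open>A v\<close> to exactly two.\<close>
    moreover have "card {n, n + 1} \<le> card (A v \<union> {n, n + 1})"
      by (rule card_mono) (simp_all add: A_def)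
    ultimately show ?thesis
      using exists_subset_between[of "A v" 2 "A v \<union> {n, n + 1}"] d by auto
  qed
  then have "\<exists>T. \<forall>v\<in>V. A v \<subseteq> T v \<and> card (T v) = 2" by (intro bchoice ballI)
  then obtain T where T: "\<And>v. v \<in> V \<Longrightarrow> A v \<subseteq> T v" "\<And>v. v \<in> V \<Longrightarrow> card (T v) = 2"
    by blast
  \<comment> \<open>In the added dimensions all boxes have the same one-point interval, so these
    never separate two boxes.\<close>
  define C where "C v i = (if i < n then B v i else {0})" for v i
  have "C v i \<noteq> {}" "is_interval (C v i)" if "v \<in> V" for v i
    using box[OF that, of i] unfolding C_def real_interval_def
    by (cases "i < n"; auto simp: is_interval_1)+
  then have "\<exists>l r :: 'a \<Rightarrow> real. (\<forall>v\<in>V. l v \<le> r v) \<and>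
      (\<forall>u\<in>V. \<forall>v\<in>V. C u i \<inter> C v i \<noteq> {} \<longleftrightarrow> l u \<le> r v \<and> l v \<le> r u)" for i
    by (intro closed_intervals[OF fin, of "\<lambda>v. C v i"])
  then obtain l r :: "nat \<Rightarrow> 'a \<Rightarrow> real" where
    "\<And>i. (\<forall>v\<in>V. l i v \<le> r i v) \<and>
      (\<forall>u\<in>V. \<forall>v\<in>V. C u i \<inter> C v i \<noteq> {} \<longleftrightarrow> l i u \<le> r i v \<and> l i v \<le> r i u)"
    by (metis (no_types, lifting))
  then have lr: "\<And>i v. v \<in> V \<Longrightarrow> l i v \<le> r i v"
      "\<And>i u v. u \<in> V \<Longrightarrow> v \<in> V \<Longrightarrow>
        C u i \<inter> C v i \<noteq> {} \<longleftrightarrow> l i u \<le> r i v \<and> l i v \<le> r i u"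
    by blast+
  let ?l = "\<lambda>v i. l i v" and ?r = "\<lambda>v i. r i v"
  have adj: "box_adj T ?l ?r u v \<longleftrightarrow> {u, v} \<in> E" if uv: "u \<in> V" "v \<in> V" "u \<noteq> v" for u v
  proof -
    have "{u, v} \<in> E \<longleftrightarrow> (\<forall>i<n. B u i \<inter> B v i \<noteq> {})"
      using rep uv unfolding local_box_representation_def PiE_Int PiE_eq_empty_iff by auto
    also have "\<dots> \<longleftrightarrow> (\<forall>i\<in>T u \<inter> T v. C u i \<inter> C v i \<noteq> {})"
    proof
      assume *: "\<forall>i\<in>T u \<inter> T v. C u i \<inter> C v i \<noteq> {}"
      show "\<forall>i<n. B u i \<inter> B v i \<noteq> {}"
      proof (intro allI impI)
        fix i assume "i < n"
        show "B u i \<inter> B v i \<noteq> {}"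
        proof (cases "i \<in> T u \<inter> T v")
          case True
          then have "C u i \<inter> C v i \<noteq> {}" using * by blast
          then show ?thesis using \<open>i < n\<close> by (simp add: C_def)
        next
          case False
          \<comment> \<open>An unbounded \<open>real_interval\<close> is the whole line, and it
            meets the other, nonempty factor.\<close>
          then have "B u i = UNIV \<or> B v i = UNIV"
            using T(1) uv box[of u i] box[of v i] \<open>i < n\<close> unfolding real_interval_def A_def by blast
          then show ?thesis
            using box[of u i] box[of v i] uv \<open>i < n\<close> unfolding real_interval_def by auto
        qed
      qed
    qed (simp add: C_def)
    also have "\<dots> \<longleftrightarrow> box_adj T ?l ?r u v" using lr(2) uv unfolding box_adj_def by simp
    finally show ?thesis by simp
  qed
  interpret triangle_free_boxes V T ?l ?r
  proof
    fix u v w assume "u \<in> V" "v \<in> V" "w \<in> V" "u \<noteq> v" "v \<noteq> w" "u \<noteq> w"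
      "box_adj T ?l ?r u v" "box_adj T ?l ?r v w"
    then show "\<not> box_adj T ?l ?r u w"
      using E(2) adj unfolding triangle_free_def by blast
  qed (use fin T(2) lr(1) in auto)
  show ?thesis
    using adj_colourable_16 by (rule colourable_mono) (use adj in auto)
qed

theorem theorem1p8:
  fixes V :: "'a set" and E :: "'a set set"
  assumes "simple_graph V E"
    and "triangle_free E"
    and "lbox V E \<le> 2"
  shows "chromatic_number V E \<le> 18"
proof -
  have "\<exists>n B. local_box_representation V E (lbox V E) n B"
    unfolding lbox_def using simple_graph_ex_representation[OF assms(1)] by (rule LeastI_ex)
  then have "colourable V (\<lambda>u v. {u, v} \<in> E) 16"
    using representation_colourable assms by blast
  then obtain c :: "'a \<Rightarrow> nat" where c: "\<And>v. v \<in> V \<Longrightarrow> c v < 16"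
      "\<And>u v. \<lbrakk>u \<in> V; v \<in> V; u \<noteq> v; {u, v} \<in> E\<rbrakk> \<Longrightarrow> c u \<noteq> c v"
    by (rule colourableE) blast
  have "u \<in> V \<and> v \<in> V \<and> u \<noteq> v" if uv: "{u, v} \<in> E" for u v
  proof -
    obtain x y where "x \<in> V" "y \<in> V" "x \<noteq> y" "{u, v} = {x, y}"
      using assms(1) uv unfolding simple_graph_def by blast
    then show ?thesis by (auto simp: doubleton_eq_iff)
  qed
  then have "\<And>u v. {u, v} \<in> E \<Longrightarrow> c u \<noteq> c v" using c(2) by blast
  moreover have "c v < 18" if "v \<in> V" for v using c(1)[OF that] by simp
  ultimately have "proper_colouring V E 18 c" unfolding proper_colouring_def by auto
  then show ?thesis
    unfolding chromatic_number_def by (intro Least_le exI)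
qed

end
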